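(* Let $M\cong\mathbb{Z}^n$ be a lattice with $n\ge 3$, and let $P\subseteq M_{\mathbb R}=M\otimes_{\mathbb Z}\mathbb R$ be an $n$-dimensional reflexive polytope. For $k\ge 0$ let $\Lambda_k\subseteq M$ denote the sublattice generated by all lattice points of $M$ lying in the $k$-skeleton of $P$ (the union of all $k$-dimensional faces of $P$). Then $\Lambda_{n-2}=\Lambda_{n-1}$; that is, the lattice generated by all lattice points in the boundary of $P$ is already generated by the lattice points lying in faces of $P$ of codimension two.
   Context: Let $N=\mathrm{Hom}_{\mathbb Z}(M,\mathbb Z)$ be the dual lattice, with pairing $\langle\cdot,\cdot\rangle$ between $N$ and $M$ (extended to $N_{\mathbb R}\times M_{\mathbb R}$). A reflexive polytope is an $n$-dimensional lattice polytope $P\subseteq M_{\mathbb R}$ (i.e., with vertices in $M$) that contains the origin in its interior and whose dual polytope $P^*=\{u\in N_{\mathbb R}:\langle u,m\rangle\ge -1\ \forall m\in P\}$ is a lattice polytope with respect to $N$. Equivalently, every facet $F$ of $P$ is of the form $F=\{m\in P:\langle \eta_F,m\rangle=-1\}$ for a unique $\eta_F\in N$ with $\langle\eta_F,m\rangle\ge -1$ for all $m\in P$. *)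

theory Defs
  imports "HOL-Analysis.Analysis"
begin

text \<open>Lattice M = Z^n inside M_R = R^n (coordinates in the standard basis);
  the dual lattice N is identified with Z^n via the standard inner product.\<close>

definition lattice_point :: "real^'n \<Rightarrow> bool" where
  "lattice_point x \<longleftrightarrow> (\<forall>i. x $ i \<in> \<int>)"

definition lattice_polytope :: "(real^'n) set \<Rightarrow> bool" where
  "lattice_polytope P \<longleftrightarrow> polytope P \<and> (\<forall>v. v extreme_point_of P \<longrightarrow> lattice_point v)"

definition dual_polytope :: "(real^'n) set \<Rightarrow> (real^'n) set" where
  "dual_polytope P = {u. \<forall>m\<in>P. u \<bullet> m \<ge> -1}"

definition reflexive_polytope :: "(real^'n) set \<Rightarrow> bool" where
  "reflexive_polytope P \<longleftrightarrow>
     lattice_polytope P \<and> aff_dim P = int CARD('n) \<and> 0 \<in> interior P \<and>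
     lattice_polytope (dual_polytope P)"

definition lattice_generated :: "(real^'n) set \<Rightarrow> (real^'n) set" where
  "lattice_generated S =
     {x. \<exists>T c. finite T \<and> T \<subseteq> S \<and> x = (\<Sum>v\<in>T. real_of_int (c v) *\<^sub>R v)}"

definition skeleton :: "int \<Rightarrow> (real^'n) set \<Rightarrow> (real^'n) set" where
  "skeleton k P = \<Union>{F. F face_of P \<and> aff_dim F = k}"

definition Lambda :: "int \<Rightarrow> (real^'n) set \<Rightarrow> (real^'n) set" where
  "Lambda k P = lattice_generated {x \<in> skeleton k P. lattice_point x}"

end

theory Submission
  imports Defs
begin

text \<open>Call a lattice point of \<open>P\<close> bad if it is not in \<open>\<Lambda>\<^sub>n\<^sub>-\<^sub>2\<close>; it then lies on exactly one facet,
  and by integrality the other facet normals are nonnegative on it. So if \<open>m\<close> is bad on the facet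
  \<open>\<eta>\<close>, lattice points at height \<open>h \<ge> 0\<close> over \<open>\<eta>\<close> can be pushed down by \<open>h m\<close> inside \<open>P\<close>, and the
  nonzero lattice points at height 0 are bad again. Pushing down the vertices off \<open>\<eta>\<close> yields a bad
  \<open>u\<close> on a facet \<open>\<theta>\<close> with \<open>\<eta>(u) = \<theta>(m) = 0\<close>. Every vertex lies on \<open>\<eta>\<close> or \<open>\<theta>\<close>, and the ones not on
  both are \<open>w = u - h m\<close> and \<open>x = m - k u\<close>, which lie on all remaining facets. As
  \<open>m + u\<close>, \<open>w\<close>, \<open>x\<close> are in \<open>\<Lambda>\<^sub>n\<^sub>-\<^sub>2\<close>, so are \<open>(h + 1) m\<close> and \<open>(k + 1) m\<close>. Integrality of the remaining
  facet normals leaves few cases: either \<open>- m\<close> or \<open>- u\<close> lies on all remaining facets, of which there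
  are at least two because \<open>n \<ge> 3\<close>, or \<open>{h, k} = {1, 2}\<close> and \<open>m = 3 m - 2 m\<close>.\<close>

section \<open>Lattice points and integer spans\<close>

lemma lattice_point_add: "lattice_point x \<Longrightarrow> lattice_point y \<Longrightarrow> lattice_point (x + y)"
  by (auto simp: lattice_point_def)

lemma lattice_point_uminus: "lattice_point x \<Longrightarrow> lattice_point (- x)"
  by (auto simp: lattice_point_def)

lemma lattice_point_scaleR: "t \<in> \<int> \<Longrightarrow> lattice_point x \<Longrightarrow> lattice_point (t *\<^sub>R x)"
  by (auto simp: lattice_point_def)

lemma lattice_point_inner: "lattice_point x \<Longrightarrow> lattice_point y \<Longrightarrow> x \<bullet> y \<in> \<int>"
  by (auto simp: lattice_point_def inner_vec_def intro!: Ints_sum Ints_mult)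

lemma lattice_generated_superset: "S \<subseteq> lattice_generated S"
proof
  fix x assume "x \<in> S"
  then show "x \<in> lattice_generated S"
    unfolding lattice_generated_def
    by (intro CollectI exI[of _ "{x}"] exI[of _ "\<lambda>_. 1"]) auto
qed

lemma lattice_generated_add:
  assumes "x \<in> lattice_generated S" "y \<in> lattice_generated S"
  shows "x + y \<in> lattice_generated S"
proof -
  obtain T c where T: "finite T" "T \<subseteq> S" "x = (\<Sum>v\<in>T. real_of_int (c v) *\<^sub>R v)"
    using assms(1) by (auto simp: lattice_generated_def)
  obtain U d where U: "finite U" "U \<subseteq> S" "y = (\<Sum>v\<in>U. real_of_int (d v) *\<^sub>R v)"
    using assms(2) by (auto simp: lattice_generated_def)
  \<comment> \<open>Both coefficient functions are extended by zero to \<open>T \<union> U\<close>,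
    so that vectors occurring in both sums are counted once with the added coefficient.\<close>
  define e where "e v = (if v \<in> T then c v else 0) + (if v \<in> U then d v else 0)" for v
  have x: "x = (\<Sum>v\<in>T \<union> U. real_of_int (if v \<in> T then c v else 0) *\<^sub>R v)"
    unfolding T(3) using T U by (intro sum.mono_neutral_cong_left) auto
  have y: "y = (\<Sum>v\<in>T \<union> U. real_of_int (if v \<in> U then d v else 0) *\<^sub>R v)"
    unfolding U(3) using T U by (intro sum.mono_neutral_cong_left) auto
  have "x + y = (\<Sum>v\<in>T \<union> U. real_of_int (e v) *\<^sub>R v)"
    unfolding x y e_def by (simp add: sum.distrib[symmetric] scaleR_add_left)
  then show ?thesis
    unfolding lattice_generated_def using T U by blast
qed

lemma lattice_generated_scaleR:
  assumes "x \<in> lattice_generated S" "t \<in> \<int>"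
  shows "t *\<^sub>R x \<in> lattice_generated S"
proof -
  obtain k where k: "t = real_of_int k" using assms(2) by (auto elim: Ints_cases)
  obtain T c where T: "finite T" "T \<subseteq> S" "x = (\<Sum>v\<in>T. real_of_int (c v) *\<^sub>R v)"
    using assms(1) by (auto simp: lattice_generated_def)
  have "t *\<^sub>R x = (\<Sum>v\<in>T. real_of_int (k * c v) *\<^sub>R v)"
    by (simp add: T(3) k scaleR_sum_right)
  then show ?thesis
    unfolding lattice_generated_def using T by (intro CollectI exI[of _ T] exI[of _ "\<lambda>v. k * c v"]) auto
qed

lemma lattice_generated_least:
  assumes "S \<subseteq> lattice_generated T"
  shows "lattice_generated S \<subseteq> lattice_generated T"
proof
  fix x assume "x \<in> lattice_generated S"
  then obtain U c where U: "finite U" "U \<subseteq> S" "x = (\<Sum>v\<in>U. real_of_int (c v) *\<^sub>R v)"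
    by (auto simp: lattice_generated_def)
  have zero: "0 \<in> lattice_generated T"
    unfolding lattice_generated_def by (intro CollectI exI[of _ "{}"]) auto
  from U(1,2) have "(\<Sum>v\<in>U. real_of_int (c v) *\<^sub>R v) \<in> lattice_generated T"
  proof (induction U rule: finite_induct)
    case empty
    then show ?case using zero by simp
  next
    case (insert v U)
    then show ?case
      using assms by (auto intro!: lattice_generated_add lattice_generated_scaleR)
  qed
  then show "x \<in> lattice_generated T" by (simp add: U(3))
qed

section \<open>Integrality, orthogonal vectors and a small Diophantine system\<close>

lemma Ints_gt_minus_one:
  assumes "t \<in> \<int>" "t \<ge> -1" "t \<noteq> -1"
  shows "t \<ge> (0::real)"
proof -
  obtain k where k: "t = real_of_int k" using assms(1) by (auto elim: Ints_cases)
  have "real_of_int k > -1" using assms k by linarith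
  then have "k > -1" by linarith
  then show ?thesis by (simp add: k)
qed

lemma Ints_pos_ge_one: "t \<in> \<int> \<Longrightarrow> t > 0 \<Longrightarrow> t \<ge> (1::real)"
  by (elim Ints_cases) (metis int_one_le_iff_zero_less of_int_0_less_iff of_int_1_le_iff)

text \<open>Two vectors span a proper subspace when n is at least 3. Inside the locale, this is how
  the assumption on the dimension enters.\<close>

lemma exists_orthogonal_to_two:
  fixes a b :: "real^'n"
  assumes "CARD('n) \<ge> 3"
  obtains d where "d \<noteq> 0" "a \<bullet> d = 0" "b \<bullet> d = 0"
proof -
  have "dim {a, b} \<le> card {a, b}" by (rule dim_le_card') auto
  also have "\<dots> \<le> 2" by (simp add: card_insert_if)
  finally have "dim {a, b} < DIM(real^'n)" using assms by simp
  then have "span {a, b} \<noteq> UNIV" by (metis dim_UNIV dim_span less_irrefl)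
  then obtain d where "d \<noteq> 0" "\<forall>x\<in>span {a, b}. d \<bullet> x = 0"
    using span_not_UNIV_orthogonal by blast
  then show ?thesis using that[of d] by (auto simp: span_base inner_commute)
qed

text \<open>In the application \<open>a\<close> and \<open>b\<close> are the values of a remaining
  facet normal on \<open>m\<close> and \<open>u\<close>. If both are at least 2, let
  \<open>x\<close> be the smaller and \<open>y\<close> the larger one: \<open>x = q * y - 1\<close>
  forces \<open>q = 1\<close>, hence \<open>y = x + 1\<close> and \<open>(p - 1) * x = 2\<close>,
  which leaves only \<open>x = 2\<close> and \<open>p = 2\<close>.\<close>

lemma small_cofactors:
  fixes a b h k :: int
  assumes "h \<ge> 1" "k \<ge> 1" "a \<ge> 0" "b \<ge> 0" "b = h * a - 1" "a = k * b - 1"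
  shows "a = 1 \<or> b = 1 \<or> h = 1 \<and> k = 2 \<or> h = 2 \<and> k = 1"
proof -
  have aux: "q = 1 \<and> p = 2" if "x \<le> y" "x \<ge> 2" "y \<ge> 2" "y = p * x - 1" "x = q * y - 1" "q \<ge> 1"
    for x y p q :: int
  proof -
    have "q < 2"
    proof (rule ccontr)
      assume "\<not> q < 2"
      then have "2 * y \<le> q * y" using that(3) by (intro mult_right_mono) auto
      then show False using that(1,2,5) by linarith
    qed
    then have q: "q = 1" using that(6) by linarith
    then have px: "(p - 1) * x = 2" using that(4,5) unfolding left_diff_distrib by simp
    then have "x dvd 2" by (metis dvd_triv_right)
    then have "x \<le> 2" by (rule zdvd_imp_le) simp
    then have "x = 2" using that(2) by simp
    then show ?thesis using px q by simp
  qed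
  have "a \<noteq> 0" "b \<noteq> 0" using assms(5,6) by (metis mult_zero_right diff_0 neg_0_le_iff_le not_one_le_zero assms(3,4))+
  then consider "a = 1" | "b = 1" | "a \<ge> 2" "b \<ge> 2" using assms(3,4) by linarith
  then show ?thesis
  proof cases
    case 3
    show ?thesis
    proof (cases "a \<le> b")
      case True
      have "k = 1 \<and> h = 2" by (rule aux[OF True 3 assms(5,6,2)])
      then show ?thesis by blast
    next
      case False
      then have "b \<le> a" by simp
      have "h = 1 \<and> k = 2" by (rule aux[OF \<open>b \<le> a\<close> 3(2,1) assms(6,5,1)])
      then show ?thesis by blast
    qed
  qed auto
qed

text \<open>Eliminating the second unknown gives \<open>a' * (h * k - 1) = k + 1\<close> with a
  nonzero right-hand side, so the solution is determined by \<open>h\<close> and \<open>k\<close>. A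
  value 1 at one remaining facet therefore transfers to all of them.\<close>

lemma cofactors_one:
  fixes a b h k :: int
  assumes "k \<ge> 1" "b = h * a - 1" "a = k * b - 1" "a = 1"
    and "b' = h * a' - 1" "a' = k * b' - 1"
  shows "a' = 1"
proof -
  have "a' = k * (h * a' - 1) - 1" using assms(6) unfolding assms(5) .
  then have "a' * (h * k - 1) = k + 1" by (simp add: algebra_simps)
  moreover have "b = h - 1" using assms(2) by (simp add: assms(4))
  then have "1 = k * (h - 1) - 1" using assms(3) by (simp only: assms(4))
  then have "h * k - 1 = k + 1" by (simp add: algebra_simps)
  ultimately show ?thesis using assms(1) by simp
qed

text \<open>\<open>N\<close> stands for the vertices of the dual polytope (the facet normals of \<open>P\<close>), \<open>V\<close> for the
  vertices of \<open>P\<close> and \<open>L\<close> for \<open>\<Lambda>\<^sub>n\<^sub>-\<^sub>2\<close>.\<close>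

locale reflexive_setting =
  fixes P N V L :: "(real^'n) set"
  assumes card3: "CARD('n) \<ge> 3"
    and P_eq: "P = {x. \<forall>\<eta>\<in>N. \<eta> \<bullet> x \<ge> -1}"
    and P_hull: "P = convex hull V"
    and bounded_P: "bounded P"
    and interior_P: "0 \<in> interior P"
    and N_lattice: "\<eta> \<in> N \<Longrightarrow> lattice_point \<eta>"
    and N_tight: "\<eta> \<in> N \<Longrightarrow> (\<And>v. v \<in> V \<Longrightarrow> \<eta> \<bullet> v = -1 \<Longrightarrow> d \<bullet> v = 0) \<Longrightarrow> d = 0"
    and V_lattice: "v \<in> V \<Longrightarrow> lattice_point v"
    and V_L: "v \<in> V \<Longrightarrow> v \<in> L"
    and V_nonzero: "v \<in> V \<Longrightarrow> v \<noteq> 0"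
    and L_add: "x \<in> L \<Longrightarrow> y \<in> L \<Longrightarrow> x + y \<in> L"
    and L_scaleR: "x \<in> L \<Longrightarrow> t \<in> \<int> \<Longrightarrow> t *\<^sub>R x \<in> L"
    and zero_L: "0 \<in> L"
    and L_ridge: "\<eta> \<in> N \<Longrightarrow> \<theta> \<in> N \<Longrightarrow> \<eta> \<noteq> \<theta> \<Longrightarrow> y \<in> P \<Longrightarrow> lattice_point y \<Longrightarrow>
        \<eta> \<bullet> y = -1 \<Longrightarrow> \<theta> \<bullet> y = -1 \<Longrightarrow> y \<in> L"
begin

section \<open>Consequences of boundedness, integrality and the interior origin\<close>

lemma L_uminus: "x \<in> L \<Longrightarrow> - x \<in> L"
  using L_scaleR[of x "-1"] by simp

lemma L_diff: "x \<in> L \<Longrightarrow> y \<in> L \<Longrightarrow> x - y \<in> L"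
  using L_add[of x "-y"] L_uminus by simp

lemma P_ge: "x \<in> P \<Longrightarrow> \<eta> \<in> N \<Longrightarrow> \<eta> \<bullet> x \<ge> -1"
  by (simp add: P_eq)

lemma V_P: "v \<in> V \<Longrightarrow> v \<in> P"
  by (simp add: P_hull hull_inc)

lemma inner_Ints: "\<eta> \<in> N \<Longrightarrow> lattice_point x \<Longrightarrow> \<eta> \<bullet> x \<in> \<int>"
  by (simp add: N_lattice lattice_point_inner)

lemma inner_nonneg:
  "\<eta> \<in> N \<Longrightarrow> x \<in> P \<Longrightarrow> lattice_point x \<Longrightarrow> \<eta> \<bullet> x \<noteq> -1 \<Longrightarrow> \<eta> \<bullet> x \<ge> 0"
  by (meson Ints_gt_minus_one P_ge inner_Ints)

text \<open>A nonzero direction would give points of \<open>P\<close> of arbitrarily large norm.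
  Arbitrarily large parameters suffice, which suits iterations whose parameters only grow.\<close>

lemma ray_zero:
  assumes "\<And>i::nat. \<exists>t\<ge>real i. m + t *\<^sub>R c \<in> P"
  shows "c = 0"
proof (rule ccontr)
  assume c: "c \<noteq> 0"
  obtain B where B: "\<And>x. x \<in> P \<Longrightarrow> norm x \<le> B"
    using bounded_P by (auto simp: bounded_iff)
  obtain i :: nat where i: "(B + norm m) / norm c < real i"
    using reals_Archimedean2 by blast
  obtain t where t: "t \<ge> real i" "m + t *\<^sub>R c \<in> P" using assms by blast
  have "norm (t *\<^sub>R c) \<le> norm (m + t *\<^sub>R c) + norm m"
    by (metis add_diff_cancel_left' norm_triangle_ineq4)
  then have "t * norm c \<le> B + norm m"
    using B[OF t(2)] t(1) by auto
  then have "t \<le> (B + norm m) / norm c" using c by (simp add: pos_le_divide_eq)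
  then show False using i t by linarith
qed

text \<open>The whole ray from the origin through \<open>y\<close> satisfies the inequalities of
  \<open>P\<close>.\<close>

lemma nonneg_zero:
  assumes "\<And>\<zeta>. \<zeta> \<in> N \<Longrightarrow> \<zeta> \<bullet> y \<ge> 0"
  shows "y = 0"
proof (rule ray_zero[of 0])
  fix i :: nat
  have "0 + real i *\<^sub>R y \<in> P"
    using assms by (auto simp: P_eq intro: order_trans[of "-1" 0])
  then show "\<exists>t\<ge>real i. 0 + t *\<^sub>R y \<in> P" by blast
qed

text \<open>The inequality passes to the hull \<open>P\<close>, which contains a small positive
  multiple of \<open>d\<close> because the origin is interior.\<close>

lemma V_halfspace:
  assumes "\<And>v. v \<in> V \<Longrightarrow> d \<bullet> v \<le> 0"
  shows "d = 0"
proof (rule ccontr)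
  assume d: "d \<noteq> 0"
  have "P \<subseteq> {x. d \<bullet> x \<le> 0}"
    unfolding P_hull by (rule hull_minimal) (use assms in \<open>auto simp: convex_halfspace_le\<close>)
  moreover obtain e where e: "e > 0" "cball 0 e \<subseteq> P"
    using interior_P by (auto simp: mem_interior_cball)
  moreover have "(e / norm d) *\<^sub>R d \<in> cball 0 e" using d e by simp
  ultimately have "d \<bullet> ((e / norm d) *\<^sub>R d) \<le> 0" by blast
  then have "(e / norm d) * (d \<bullet> d) \<le> 0" by simp
  moreover have "(e / norm d) * (d \<bullet> d) > 0" using d e by simp
  ultimately show False by linarith
qed

lemma exists_vertex_off:
  assumes "\<eta> \<in> N"
  obtains w where "w \<in> V" "\<eta> \<bullet> w \<noteq> -1"
proof (rule ccontr)
  assume "\<not> thesis"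
  then have *: "\<And>v. v \<in> V \<Longrightarrow> \<eta> \<bullet> v = -1" using that by blast
  then have "\<eta> = 0" by (intro V_halfspace) auto
  then have "V = {}" using * by fastforce
  then show False using interior_P P_hull by simp
qed

section \<open>Bad lattice points\<close>

text \<open>The only facet through the point is carried along as an argument, since shifts are
  measured against it. By \<open>exists_bad\<close>, every lattice point of \<open>P\<close> outside
  \<open>L\<close> is bad for some facet.\<close>

definition bad :: "real^'n \<Rightarrow> real^'n \<Rightarrow> bool" where
  "bad m \<eta> \<longleftrightarrow> m \<in> P \<and> lattice_point m \<and> m \<notin> L \<and> \<eta> \<in> N \<and> \<eta> \<bullet> m = -1 \<and>
     (\<forall>\<zeta>\<in>N. \<zeta> \<noteq> \<eta> \<longrightarrow> \<zeta> \<bullet> m \<ge> 0)"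

lemma badD:
  assumes "bad m \<eta>"
  shows "m \<in> P" "lattice_point m" "m \<notin> L" "\<eta> \<in> N" "\<eta> \<bullet> m = -1"
    "\<And>\<zeta>. \<zeta> \<in> N \<Longrightarrow> \<zeta> \<noteq> \<eta> \<Longrightarrow> \<zeta> \<bullet> m \<ge> 0"
  using assms by (auto simp: bad_def)

lemma bad_unique: "bad m \<eta> \<Longrightarrow> \<zeta> \<in> N \<Longrightarrow> \<zeta> \<bullet> m = -1 \<Longrightarrow> \<zeta> = \<eta>"
  by (metis badD(6) neg_0_le_iff_le not_one_le_zero)

lemma bad_nonzero: "bad m \<eta> \<Longrightarrow> m \<noteq> 0"
  using badD(3) zero_L by blast

text \<open>Since \<open>y\<close> is nonzero, some facet normal is negative on it, hence -1 by
  integrality. A second facet through \<open>y\<close> would put it in \<open>L\<close> by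
  \<open>L_ridge\<close>.\<close>

lemma exists_bad:
  assumes "y \<in> P" "lattice_point y" "y \<notin> L"
  obtains \<eta> where "bad y \<eta>"
proof -
  have "\<exists>\<eta>\<in>N. \<eta> \<bullet> y = -1"
    using nonneg_zero[of y] inner_nonneg[of _ y] assms zero_L by blast
  then obtain \<eta> where \<eta>: "\<eta> \<in> N" "\<eta> \<bullet> y = -1" by blast
  have "\<zeta> \<bullet> y \<ge> 0" if "\<zeta> \<in> N" "\<zeta> \<noteq> \<eta>" for \<zeta>
    using L_ridge[of \<eta> \<zeta> y] inner_nonneg[of \<zeta> y] assms \<eta> that by blast
  then show ?thesis using that \<eta> assms by (auto simp: bad_def)
qed

text \<open>Adding \<open>j *\<^sub>R m\<close> lowers the value of \<eta> by \<open>j\<close> and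
  decreases no other facet normal, because all others are nonnegative on \<open>m\<close>.\<close>

lemma bad_shift:
  assumes "bad m \<eta>" "y \<in> P" "0 \<le> j" "j \<le> \<eta> \<bullet> y + 1"
  shows "y + j *\<^sub>R m \<in> P"
proof -
  have "\<zeta> \<bullet> (y + j *\<^sub>R m) \<ge> -1" if "\<zeta> \<in> N" for \<zeta>
  proof (cases "\<zeta> = \<eta>")
    case True
    then show ?thesis using assms badD(5)[OF assms(1)] by (simp add: inner_add_right)
  next
    case False
    then have "j * (\<zeta> \<bullet> m) \<ge> 0" using assms badD(6) that by simp
    then show ?thesis using P_ge[OF assms(2) that] by (simp add: inner_add_right)
  qed
  then show ?thesis by (simp add: P_eq)
qed

text \<open>If \<open>y\<close> were in \<open>L\<close>, all \<open>m + k y\<close> would again be bad for the same facet, and so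
  the whole ray would stay in \<open>P\<close>.\<close>

lemma level_zero_notin_L:
  assumes m: "bad m \<eta>" and y: "y \<in> P" "lattice_point y" "y \<noteq> 0" "\<eta> \<bullet> y = 0"
  shows "y \<notin> L"
proof
  assume yL: "y \<in> L"
  have "bad (m + real k *\<^sub>R y) \<eta>" for k :: nat
  proof (induction k)
    case 0
    then show ?case using m by simp
  next
    case (Suc k)
    let ?z = "m + real k *\<^sub>R y"
    have eq: "m + real (Suc k) *\<^sub>R y = y + 1 *\<^sub>R ?z" by (simp add: algebra_simps)
    have "y + 1 *\<^sub>R ?z \<in> P" by (rule bad_shift[OF Suc]) (use y in auto)
    moreover have "lattice_point (y + 1 *\<^sub>R ?z)"
      using y badD(2)[OF Suc] by (simp add: lattice_point_add)
    moreover have "y + 1 *\<^sub>R ?z \<notin> L"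
      using L_diff[of "y + 1 *\<^sub>R ?z" y] yL badD(3)[OF Suc] by auto
    ultimately obtain \<zeta> where \<zeta>: "bad (y + 1 *\<^sub>R ?z) \<zeta>" by (rule exists_bad)
    moreover have "\<eta> = \<zeta>"
      by (rule bad_unique[OF \<zeta>]) (use badD(4,5)[OF Suc] y(4) in \<open>auto simp: inner_add_right\<close>)
    ultimately show ?case by (simp only: eq)
  qed
  then have "y = 0"
    by (intro ray_zero[of m]) (use badD(1) in blast)
  then show False using y by simp
qed

lemma level_zero_bad:
  assumes "bad m \<eta>" "y \<in> P" "lattice_point y" "y \<noteq> 0" "\<eta> \<bullet> y = 0"
  obtains \<theta> where "bad y \<theta>"
  using level_zero_notin_L[OF assms] exists_bad assms by blast

text \<open>Vertices are nonzero and belong to \<open>L\<close>, so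
  \<open>level_zero_notin_L\<close> excludes the value 0; integrality does the rest.\<close>

lemma vertex_level_pos:
  assumes "bad m \<eta>" "v \<in> V" "\<eta> \<bullet> v \<noteq> -1"
  shows "\<eta> \<bullet> v \<ge> 1"
proof -
  have "\<eta> \<bullet> v \<noteq> 0"
    using level_zero_notin_L[OF assms(1)] assms V_P V_lattice V_nonzero V_L by blast
  moreover have "\<eta> \<bullet> v \<ge> 0"
    using inner_nonneg assms V_P V_lattice badD(4) by blast
  ultimately show ?thesis
    using Ints_pos_ge_one[of "\<eta> \<bullet> v"] inner_Ints badD(4)[OF assms(1)] V_lattice assms(2) by auto
qed

text \<open>Some facet normal is positive on \<open>m\<close>, hence at least 1 there, and its value
  at \<open>- (h *\<^sub>R m)\<close> must not fall below -1.\<close>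

lemma bad_opposite_multiple:
  assumes "bad m \<eta>" "- (h *\<^sub>R m) \<in> P" "h \<ge> 1"
  shows "h = 1"
proof -
  have "\<not> (\<forall>\<zeta>\<in>N. \<zeta> \<bullet> (- m) \<ge> 0)"
    using nonneg_zero[of "- m"] bad_nonzero[OF assms(1)] by auto
  then obtain \<zeta> where \<zeta>: "\<zeta> \<in> N" "\<zeta> \<bullet> m > 0" by auto
  then have g: "\<zeta> \<bullet> m \<ge> 1" using Ints_pos_ge_one inner_Ints badD(2)[OF assms(1)] by blast
  have "h * (\<zeta> \<bullet> m) \<le> 1" using P_ge[OF assms(2) \<zeta>(1)] by simp
  moreover have "h * 1 \<le> h * (\<zeta> \<bullet> m)" using g assms(3) by (intro mult_left_mono) auto
  ultimately show ?thesis using assms(3) by linarith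
qed

section \<open>Pairs of bad points, each at level zero over the facet of the other\<close>

text \<open>The pushed-down vertex is nonzero, since otherwise \<open>m = - w\<close> would lie in
  \<open>L\<close>; being at level zero, it is bad for some \<theta>. In
  \<open>\<theta> \<bullet> w + h * (\<theta> \<bullet> m) = -1\<close> the first term is at least
  -1 and the second nonnegative, so both are extremal.\<close>

lemma shift_vertex:
  assumes m: "bad m \<eta>" and w: "w \<in> V" and h: "h = \<eta> \<bullet> w" "h \<ge> 1"
  obtains \<theta> where "bad (w + h *\<^sub>R m) \<theta>" "\<theta> \<bullet> m = 0" "\<theta> \<bullet> w = -1"
    "\<eta> \<bullet> (w + h *\<^sub>R m) = 0"
proof -
  let ?u = "w + h *\<^sub>R m"
  have hI: "h \<in> \<int>" using h inner_Ints V_lattice[OF w] badD(4)[OF m] by blast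
  have uP: "?u \<in> P" by (rule bad_shift[OF m V_P[OF w]]) (use h in auto)
  have ul: "lattice_point ?u"
    using lattice_point_add lattice_point_scaleR V_lattice[OF w] hI badD(2)[OF m] by blast
  have \<eta>u: "\<eta> \<bullet> ?u = 0" using h badD(5)[OF m] by (simp add: inner_add_right)
  have "?u \<noteq> 0"
  proof
    assume "?u = 0"
    then have w': "w = - (h *\<^sub>R m)" by (simp add: eq_neg_iff_add_eq_0)
    then have "h = 1" using bad_opposite_multiple[OF m] V_P[OF w] h by simp
    then have "m = - w" using w' by simp
    then show False using L_uminus V_L[OF w] badD(3)[OF m] by blast
  qed
  then obtain \<theta> where \<theta>: "bad ?u \<theta>" using level_zero_bad[OF m uP ul] \<eta>u by blast
  have ne: "\<theta> \<noteq> \<eta>" using badD(5)[OF \<theta>] \<eta>u by auto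
  have nn: "\<theta> \<bullet> m \<ge> 0" using badD(6)[OF m badD(4)[OF \<theta>] ne] .
  have e: "\<theta> \<bullet> w + h * (\<theta> \<bullet> m) = -1" using badD(5)[OF \<theta>] by (simp add: inner_add_right)
  have "\<theta> \<bullet> w \<ge> -1" using P_ge V_P[OF w] badD(4)[OF \<theta>] by blast
  moreover have "h * (\<theta> \<bullet> m) \<ge> 0" using nn h by simp
  ultimately have "h * (\<theta> \<bullet> m) = 0" "\<theta> \<bullet> w = -1" using e by linarith+
  then show ?thesis using that[OF \<theta>] h \<eta>u by auto
qed

text \<open>Each of the two normals is -1 on one summand and 0 on the other, so the sum lies on both
  facets.\<close>

lemma bad_pair_sum_in_L:
  assumes m: "bad m \<eta>" and u: "bad u \<theta>" and z: "\<eta> \<bullet> u = 0" "\<theta> \<bullet> m = 0"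
  shows "m + u \<in> L"
proof (rule L_ridge[of \<eta> \<theta>])
  show "\<eta> \<noteq> \<theta>" using badD(5)[OF u] z by auto
  show "m + u \<in> P" using bad_shift[OF u badD(1)[OF m], of 1] z by simp
qed (use badD[OF m] badD[OF u] z in \<open>auto simp: inner_add_right lattice_point_add\<close>)

text \<open>If \<phi> vanished on \<open>u\<close>, adding multiples of \<open>u\<close> to
  \<open>v\<close> would keep it on the facet \<phi> until it also reaches \<theta>. This gives a
  nonzero point of \<open>L\<close> at level zero over \<eta>, which is impossible.\<close>

lemma level_zero_bad_opposite_aux:
  assumes m: "bad m \<eta>" and u: "bad u \<theta>" "\<eta> \<bullet> u = 0" and v: "bad v \<phi>" "\<eta> \<bullet> v = 0"
    and ne: "\<theta> \<noteq> \<phi>"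
  shows "\<phi> \<bullet> u \<ge> 1"
proof (rule ccontr)
  assume "\<not> ?thesis"
  moreover have "\<phi> \<bullet> u \<ge> 0" using badD(6)[OF u(1) badD(4)[OF v(1)]] ne by auto
  ultimately have z: "\<phi> \<bullet> u = 0"
    using Ints_pos_ge_one inner_Ints badD(4)[OF v(1)] badD(2)[OF u(1)] by (metis order_le_less)
  define g where "g = \<theta> \<bullet> v"
  have g: "g \<ge> 0" "g \<in> \<int>"
    using badD(6)[OF v(1) badD(4)[OF u(1)] ne] inner_Ints badD(4)[OF u(1)] badD(2)[OF v(1)]
    by (auto simp: g_def)
  \<comment> \<open>The factor is \<open>g + 1\<close>, not \<open>g\<close>: \<theta> must drop
    from \<open>g\<close> all the way to -1.\<close>
  let ?y = "v + (g + 1) *\<^sub>R u"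
  have yP: "?y \<in> P" by (rule bad_shift[OF u(1) badD(1)[OF v(1)]]) (use g in \<open>auto simp: g_def\<close>)
  have yl: "lattice_point ?y"
    using g badD(2)[OF u(1)] badD(2)[OF v(1)] by (auto intro!: lattice_point_add lattice_point_scaleR)
  have t: "\<theta> \<bullet> ?y = -1" "\<phi> \<bullet> ?y = -1" "\<eta> \<bullet> ?y = 0"
    using u v z badD(5)[OF u(1)] badD(5)[OF v(1)] by (auto simp: inner_add_right g_def)
  have "?y \<in> L" using L_ridge[OF badD(4)[OF u(1)] badD(4)[OF v(1)] ne yP yl] t by blast
  moreover have "?y \<noteq> 0" using t(1) by auto
  ultimately show False using level_zero_notin_L[OF m yP yl] t by blast
qed

text \<open>Adding \<open>g\<close> copies of \<open>u\<close> to \<open>v\<close> brings \<theta>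
  exactly to 0. It makes \<phi> nonnegative since \<open>\<phi> \<bullet> u\<close> and
  \<open>g\<close> are at least 1, and it keeps the other normals nonnegative. So the sum is 0, and
  \<open>bad_opposite_multiple\<close> yields \<open>g = 1\<close>.\<close>

lemma level_zero_bad_opposite:
  assumes m: "bad m \<eta>" and u: "bad u \<theta>" "\<eta> \<bullet> u = 0" and v: "bad v \<phi>" "\<eta> \<bullet> v = 0"
    and ne: "\<theta> \<noteq> \<phi>"
  shows "v = - u"
proof -
  define g where "g = \<theta> \<bullet> v"
  have g: "g \<ge> 1" unfolding g_def using level_zero_bad_opposite_aux[OF m v u] ne by simp
  have g': "\<phi> \<bullet> u \<ge> 1" using level_zero_bad_opposite_aux[OF m u v] ne by simp
  have gI: "g \<in> \<int>"
    using inner_Ints badD(4)[OF u(1)] badD(2)[OF v(1)] by (auto simp: g_def)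
  let ?y = "v + g *\<^sub>R u"
  have yP: "?y \<in> P" by (rule bad_shift[OF u(1) badD(1)[OF v(1)]]) (use g in \<open>auto simp: g_def\<close>)
  have yl: "lattice_point ?y"
    using gI badD(2)[OF u(1)] badD(2)[OF v(1)] by (auto intro!: lattice_point_add lattice_point_scaleR)
  have "?y = 0"
  proof (rule nonneg_zero)
    fix \<zeta> assume \<zeta>: "\<zeta> \<in> N"
    consider "\<zeta> = \<theta>" | "\<zeta> = \<phi>" | "\<zeta> \<noteq> \<theta>" "\<zeta> \<noteq> \<phi>" by blast
    then show "\<zeta> \<bullet> ?y \<ge> 0"
    proof cases
      case 1
      then show ?thesis using badD(5)[OF u(1)] by (simp add: inner_add_right g_def)
    next
      case 2
      have "1 * 1 \<le> g * (\<phi> \<bullet> u)" using g g' by (intro mult_mono) auto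
      then show ?thesis using badD(5)[OF v(1)] 2 by (simp add: inner_add_right)
    next
      case 3
      then show ?thesis using badD(6)[OF u(1) \<zeta>] badD(6)[OF v(1) \<zeta>] g
        by (simp add: inner_add_right)
    qed
  qed
  then have v': "v = - (g *\<^sub>R u)" by (simp add: eq_neg_iff_add_eq_0)
  then have "g = 1" using bad_opposite_multiple[OF u(1)] badD(1)[OF v(1)] g by simp
  then show ?thesis using v' by simp
qed

text \<open>The vertex pushed down to level zero is bad for a facet differing from \<theta> or from
  \<theta>'. By \<open>level_zero_bad_opposite\<close> it is then the opposite of \<open>u\<close>
  or of \<open>- u\<close>.\<close>

lemma vertex_in_plane:
  assumes m: "bad m \<eta>" and u: "bad u \<theta>" and u': "bad (- u) \<theta>'" and z: "\<eta> \<bullet> u = 0"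
    and v: "v \<in> V" "\<eta> \<bullet> v \<noteq> -1"
  obtains a b where "v = a *\<^sub>R m + b *\<^sub>R u"
proof -
  have ne: "\<theta> \<noteq> \<theta>'" using badD(5)[OF u] badD(5)[OF u'] by auto
  define h where "h = \<eta> \<bullet> v"
  obtain \<phi> where \<phi>: "bad (v + h *\<^sub>R m) \<phi>" "\<eta> \<bullet> (v + h *\<^sub>R m) = 0"
    using shift_vertex[OF m v(1) h_def] vertex_level_pos[OF m v] by (auto simp: h_def)
  have "v + h *\<^sub>R m = - u \<or> v + h *\<^sub>R m = - (- u)"
    using level_zero_bad_opposite[OF m u z \<phi>] level_zero_bad_opposite[OF m u' _ \<phi>] z ne by auto
  then have "v = (- h) *\<^sub>R m + (-1) *\<^sub>R u \<or> v = (- h) *\<^sub>R m + 1 *\<^sub>R u"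
    by (auto simp: algebra_simps)
  then show ?thesis using that by blast
qed

text \<open>A vertex off both facets makes \<open>- m\<close> bad for a facet \<open>\<eta>'\<close>; then \<open>\<eta> + \<eta>' \<le> 0\<close> on all
  vertices, so \<open>\<eta>' = - \<eta>\<close>, and all vertices lie in the plane of \<open>m\<close> and \<open>u\<close>.\<close>

lemma vertex_on_pair:
  assumes m: "bad m \<eta>" and u: "bad u \<theta>" and z: "\<eta> \<bullet> u = 0" "\<theta> \<bullet> m = 0" and v: "v \<in> V"
  shows "\<eta> \<bullet> v = -1 \<or> \<theta> \<bullet> v = -1"
proof (rule ccontr)
  assume off: "\<not> ?thesis"
  define h k where "h = \<eta> \<bullet> v" and "k = \<theta> \<bullet> v"
  have hk: "h \<ge> 1" "k \<ge> 1"
    using vertex_level_pos[OF m v] vertex_level_pos[OF u v] off by (auto simp: h_def k_def)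
  obtain \<theta>' where \<theta>': "bad (v + h *\<^sub>R m) \<theta>'" "\<theta>' \<bullet> v = -1" "\<eta> \<bullet> (v + h *\<^sub>R m) = 0"
    using shift_vertex[OF m v h_def hk(1)] by blast
  have e: "v + h *\<^sub>R m = - u"
    using level_zero_bad_opposite[OF m u z(1) \<theta>'(1,3)] \<theta>'(2) off by blast
  obtain \<eta>' where \<eta>': "bad (v + k *\<^sub>R u) \<eta>'" "\<eta>' \<bullet> u = 0" "\<eta>' \<bullet> v = -1" "\<theta> \<bullet> (v + k *\<^sub>R u) = 0"
    using shift_vertex[OF u v k_def hk(2)] by blast
  have e': "v + k *\<^sub>R u = - m"
    using level_zero_bad_opposite[OF u m z(2) \<eta>'(1,4)] \<eta>'(3) off by blast
  have u': "bad (- u) \<theta>'" and m': "bad (- m) \<eta>'" using \<theta>'(1) \<eta>'(1) e e' by auto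
  have plane: "\<exists>a b. y = a *\<^sub>R m + b *\<^sub>R u" if y: "y \<in> V" "\<eta> \<bullet> y \<noteq> -1 \<or> \<eta>' \<bullet> y \<noteq> -1" for y
  proof (cases "\<eta> \<bullet> y \<noteq> -1")
    case True
    then show ?thesis using vertex_in_plane[OF m u u' z(1) y(1)] by blast
  next
    case False
    then obtain a b where "y = a *\<^sub>R (- m) + b *\<^sub>R u"
      using vertex_in_plane[OF m' u u' \<eta>'(2) y(1)] y(2) by blast
    then have "y = (- a) *\<^sub>R m + b *\<^sub>R u" by simp
    then show ?thesis by blast
  qed
  have \<eta>m: "\<eta> \<bullet> m = -1" "\<eta>' \<bullet> m = 1" using badD(5)[OF m] badD(5)[OF m'] by auto
  \<comment> \<open>The sum vanishes on \<open>m\<close> and \<open>u\<close>, hence on every vertex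
    in their plane; at any other vertex both normals are -1.\<close>
  have "\<eta> + \<eta>' = 0"
  proof (rule V_halfspace)
    fix y assume y: "y \<in> V"
    show "(\<eta> + \<eta>') \<bullet> y \<le> 0"
    proof (cases "\<eta> \<bullet> y \<noteq> -1 \<or> \<eta>' \<bullet> y \<noteq> -1")
      case True
      then obtain a b where "y = a *\<^sub>R m + b *\<^sub>R u" using plane y by blast
      then show ?thesis using \<eta>m z \<eta>'(2) by (simp add: inner_add_right inner_add_left)
    next
      case False
      then show ?thesis by (simp add: inner_add_left)
    qed
  qed
  then have neg: "\<eta>' = - \<eta>" by (simp add: eq_neg_iff_add_eq_0 add.commute)
  \<comment> \<open>No vertex lies on both \<eta> and \<open>- \<eta>\<close>, so all vertices lie
    in the plane of \<open>m\<close> and \<open>u\<close>; a nonzero vector orthogonal to that plane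
    contradicts the full dimension of \<open>P\<close>.\<close>
  obtain d where d: "d \<noteq> 0" "m \<bullet> d = 0" "u \<bullet> d = 0"
    using exists_orthogonal_to_two[OF card3] by blast
  have "d = 0"
  proof (rule V_halfspace)
    fix y assume y: "y \<in> V"
    have "\<eta> \<bullet> y \<noteq> -1 \<or> \<eta>' \<bullet> y \<noteq> -1" by (auto simp: neg)
    then obtain a b where "y = a *\<^sub>R m + b *\<^sub>R u" using plane y by blast
    then show "d \<bullet> y \<le> 0" using d by (simp add: inner_add_right inner_commute)
  qed
  then show False using d by simp
qed

text \<open>The map \<open>m \<mapsto> x + k (w + h m)\<close> preserves badness for \<open>\<eta>\<close> and expands by \<open>k h \<ge> 1\<close>, so
  boundedness forces \<open>m\<close> to be a fixed point.\<close>

lemma shift_twice_fixed: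
  assumes m: "bad m \<eta>" and u: "bad u \<theta>" and z: "\<eta> \<bullet> u = 0" "\<theta> \<bullet> m = 0"
    and w: "w \<in> V" "h = \<eta> \<bullet> w" "h \<ge> 1" and x: "x \<in> V" "k = \<theta> \<bullet> x" "k \<ge> 1"
  shows "x + k *\<^sub>R (w + h *\<^sub>R m) = m"
proof -
  have \<theta>w: "\<theta> \<bullet> w = -1" and \<eta>x: "\<eta> \<bullet> x = -1"
    using vertex_on_pair[OF m u z w(1)] vertex_on_pair[OF m u z x(1)] w x by auto
  have step: "bad (x + k *\<^sub>R (w + h *\<^sub>R m')) \<eta> \<and> \<theta> \<bullet> (x + k *\<^sub>R (w + h *\<^sub>R m')) = 0"
    if m': "bad m' \<eta>" "\<theta> \<bullet> m' = 0" for m'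
  proof -
    obtain \<phi> where \<phi>: "bad (w + h *\<^sub>R m') \<phi>" "\<eta> \<bullet> (w + h *\<^sub>R m') = 0"
      using shift_vertex[OF m'(1) w] by blast
    have "\<theta> = \<phi>"
      by (rule bad_unique[OF \<phi>(1) badD(4)[OF u]]) (use \<theta>w m' in \<open>simp add: inner_add_right\<close>)
    then have b: "bad (w + h *\<^sub>R m') \<theta>" using \<phi> by simp
    obtain \<psi> where \<psi>: "bad (x + k *\<^sub>R (w + h *\<^sub>R m')) \<psi>" "\<theta> \<bullet> (x + k *\<^sub>R (w + h *\<^sub>R m')) = 0"
      using shift_vertex[OF b x] by blast
    have "\<eta> \<bullet> (x + k *\<^sub>R (w + h *\<^sub>R m')) = \<eta> \<bullet> x + k * (\<eta> \<bullet> (w + h *\<^sub>R m'))"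
      by (simp only: inner_add_right[of \<eta> x] inner_scaleR_right)
    then have "\<eta> = \<psi>"
      by (intro bad_unique[OF \<psi>(1) badD(4)[OF m]]) (simp only: \<eta>x \<phi>(2) mult_zero_right add_0_right)
    then show ?thesis using \<psi> by simp
  qed
  define c where "c = x + k *\<^sub>R (w + h *\<^sub>R m) - m"
  have "\<exists>t\<ge>real i. bad (m + t *\<^sub>R c) \<eta> \<and> \<theta> \<bullet> (m + t *\<^sub>R c) = 0" for i :: nat
  proof (induction i)
    case 0
    show ?case using m z by (intro exI[of _ 0]) auto
  next
    case (Suc i)
    then obtain t where t: "t \<ge> real i" "bad (m + t *\<^sub>R c) \<eta>" "\<theta> \<bullet> (m + t *\<^sub>R c) = 0" by blast
    \<comment> \<open>On the line through \<open>m\<close> in direction \<open>c\<close> the map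
      acts on the parameter by sending \<open>t\<close> to \<open>1 + k * h * t\<close>, which is at
      least \<open>t + 1\<close>.\<close>
    have "x + k *\<^sub>R (w + h *\<^sub>R (m + t *\<^sub>R c)) = m + (1 + k * h * t) *\<^sub>R c"
      by (simp add: c_def algebra_simps)
    moreover have "1 * 1 \<le> k * h" using w x by (intro mult_mono) auto
    then have "1 * t \<le> k * h * t" using t by (intro mult_right_mono) auto
    then have "1 + k * h * t \<ge> real (Suc i)" using t by simp
    ultimately show ?case using step[OF t(2,3)] by metis
  qed
  then have "c = 0" by (intro ray_zero[of m]) (use badD(1) in blast)
  then show ?thesis by (simp add: c_def)
qed

section \<open>The remaining facets and the exclusion of bad points\<close>

text \<open>Otherwise \<open>\<zeta> - \<eta>\<close> would vanish on all vertices of the facet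
  \<zeta>, and these admit no nonzero orthogonal vector by \<open>N_tight\<close>.\<close>

lemma tight_vertex_off:
  assumes "\<zeta> \<in> N" "\<eta> \<in> N" "\<zeta> \<noteq> \<eta>"
  obtains w where "w \<in> V" "\<zeta> \<bullet> w = -1" "\<eta> \<bullet> w \<noteq> -1"
proof (rule ccontr)
  assume "\<not> thesis"
  then have "\<zeta> - \<eta> = 0"
    by (intro N_tight[OF assms(1)]) (use that in \<open>force simp: inner_diff_left\<close>)
  then show False using assms by simp
qed

text \<open>With at most three normals, choose a nonzero \<open>d\<close> orthogonal to two of them.
  Either \<open>d\<close> or \<open>- d\<close> is then nonnegative for the third as well, contrary
  to \<open>nonneg_zero\<close>.\<close>

lemma exists_fourth_facet:
  obtains \<zeta> where "\<zeta> \<in> N" "\<zeta> \<noteq> \<eta>" "\<zeta> \<noteq> \<theta>" "\<zeta> \<noteq> \<xi>"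
proof (rule ccontr)
  assume "\<not> thesis"
  then have N: "N \<subseteq> {\<eta>, \<theta>, \<xi>}" using that by blast
  obtain d where d: "d \<noteq> 0" "\<eta> \<bullet> d = 0" "\<theta> \<bullet> d = 0"
    using exists_orthogonal_to_two[OF card3] by blast
  have "d = 0 \<or> - d = 0"
  proof (cases "\<xi> \<bullet> d \<ge> 0")
    case True
    then have "d = 0" by (intro nonneg_zero) (use N d in auto)
    then show ?thesis by simp
  next
    case False
    then have "- d = 0" by (intro nonneg_zero) (use N d in auto)
    then show ?thesis by simp
  qed
  then show False using d by simp
qed

lemma not_bad: "\<not> bad m \<eta>"
proof
  assume m: "bad m \<eta>"
  obtain w0 where w0: "w0 \<in> V" "\<eta> \<bullet> w0 \<noteq> -1" using exists_vertex_off badD(4)[OF m] by blast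
  define h0 where "h0 = \<eta> \<bullet> w0"
  have h0: "h0 \<ge> 1" using vertex_level_pos[OF m w0] by (simp add: h0_def)
  define u where "u = w0 + h0 *\<^sub>R m"
  obtain \<theta> where u: "bad u \<theta>" and z: "\<eta> \<bullet> u = 0" "\<theta> \<bullet> m = 0"
    using shift_vertex[OF m w0(1) h0_def h0] unfolding u_def by blast
  obtain x0 where x0: "x0 \<in> V" "\<theta> \<bullet> x0 \<noteq> -1" using exists_vertex_off badD(4)[OF u] by blast
  define k0 where "k0 = \<theta> \<bullet> x0"
  have k0: "k0 \<ge> 1" using vertex_level_pos[OF u x0] by (simp add: k0_def)
  have \<eta>\<theta>: "\<eta> \<noteq> \<theta>" using z badD(5)[OF u] by auto
  \<comment> \<open>The fixed-point equation for \<open>w0\<close> and \<open>x\<close> reads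
    \<open>x + (\<theta> \<bullet> x) *\<^sub>R u = m\<close>, because \<open>u\<close> is the
    pushed-down \<open>w0\<close>.\<close>
  have x_eq: "x = m - (\<theta> \<bullet> x) *\<^sub>R u" if "x \<in> V" "\<theta> \<bullet> x \<noteq> -1" for x
    using shift_twice_fixed[OF m u z w0(1) h0_def h0 that(1) refl vertex_level_pos[OF u that]]
    by (simp add: u_def eq_diff_eq)
  \<comment> \<open>The fixed-point equations for \<open>w\<close> and for \<open>w0\<close>, both
    taken with \<open>x0\<close>, are compared and the nonzero factor \<open>k0\<close> is
    cancelled.\<close>
  have w_eq: "w = u - (\<eta> \<bullet> w) *\<^sub>R m" if "w \<in> V" "\<eta> \<bullet> w \<noteq> -1" for w
  proof -
    have "x0 + k0 *\<^sub>R (w + (\<eta> \<bullet> w) *\<^sub>R m) = m"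
      by (rule shift_twice_fixed[OF m u z that(1) refl vertex_level_pos[OF m that] x0(1) k0_def k0])
    also have "m = x0 + k0 *\<^sub>R u" using x_eq[OF x0] by (simp add: k0_def eq_diff_eq)
    finally show ?thesis using k0 by (simp add: eq_diff_eq)
  qed
  \<comment> \<open>A remaining facet has a vertex off \<eta> and a vertex off \<theta>, and
    \<open>w_eq\<close> and \<open>x_eq\<close> give their form. The multiples \<open>h\<close> and
    \<open>k\<close> might still depend on \<zeta>.\<close>
  have other: "\<exists>h k. h \<ge> 1 \<and> k \<ge> 1 \<and> u - h *\<^sub>R m \<in> V \<and> m - k *\<^sub>R u \<in> V \<and> h \<in> \<int> \<and> k \<in> \<int> \<and>
      \<zeta> \<bullet> (u - h *\<^sub>R m) = -1 \<and> \<zeta> \<bullet> (m - k *\<^sub>R u) = -1"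
    if \<zeta>: "\<zeta> \<in> N" "\<zeta> \<noteq> \<eta>" "\<zeta> \<noteq> \<theta>" for \<zeta>
  proof -
    obtain w where w: "w \<in> V" "\<zeta> \<bullet> w = -1" "\<eta> \<bullet> w \<noteq> -1"
      using tight_vertex_off[OF \<zeta>(1) badD(4)[OF m] \<zeta>(2)] .
    obtain x where x: "x \<in> V" "\<zeta> \<bullet> x = -1" "\<theta> \<bullet> x \<noteq> -1"
      using tight_vertex_off[OF \<zeta>(1) badD(4)[OF u] \<zeta>(3)] .
    show ?thesis
      using w x w_eq[OF w(1,3)] x_eq[OF x(1,3)] vertex_level_pos[OF m w(1,3)]
        vertex_level_pos[OF u x(1,3)] inner_Ints badD(4)[OF m] badD(4)[OF u] V_lattice
      by (intro exI[of _ "\<eta> \<bullet> w"] exI[of _ "\<theta> \<bullet> x"]) auto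
  qed
  obtain \<zeta>1 where \<zeta>1: "\<zeta>1 \<in> N" "\<zeta>1 \<noteq> \<eta>" "\<zeta>1 \<noteq> \<theta>" using exists_fourth_facet by metis
  obtain \<zeta>2 where \<zeta>2: "\<zeta>2 \<in> N" "\<zeta>2 \<noteq> \<eta>" "\<zeta>2 \<noteq> \<theta>" "\<zeta>2 \<noteq> \<zeta>1" using exists_fourth_facet by metis
  obtain h k where hk: "h \<ge> 1" "k \<ge> 1" "u - h *\<^sub>R m \<in> V" "m - k *\<^sub>R u \<in> V" "h \<in> \<int>" "k \<in> \<int>"
    "\<zeta>1 \<bullet> (u - h *\<^sub>R m) = -1" "\<zeta>1 \<bullet> (m - k *\<^sub>R u) = -1"
    using other[OF \<zeta>1] by blast
  obtain hi ki where hi: "h = real_of_int hi" and ki: "k = real_of_int ki"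
    using hk by (auto elim!: Ints_cases)
  have hki: "hi \<ge> 1" "ki \<ge> 1" using hk hi ki by auto
  have coeffs: "\<exists>a b::int. a \<ge> 0 \<and> b \<ge> 0 \<and> \<zeta> \<bullet> m = a \<and> \<zeta> \<bullet> u = b \<and> b = hi * a - 1 \<and> a = ki * b - 1"
    if \<zeta>: "\<zeta> \<in> N" "\<zeta> \<noteq> \<eta>" "\<zeta> \<noteq> \<theta>" for \<zeta>
  proof -
    obtain h' k' where hk': "h' \<ge> 1" "k' \<ge> 1" "u - h' *\<^sub>R m \<in> V" "m - k' *\<^sub>R u \<in> V"
      "\<zeta> \<bullet> (u - h' *\<^sub>R m) = -1" "\<zeta> \<bullet> (m - k' *\<^sub>R u) = -1"
      using other[OF \<zeta>] by blast
    \<comment> \<open>A facet through \<open>q - s *\<^sub>R p\<close> is positive on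
      \<open>p\<close>, so a vertex further along that ray would violate it. Used in both
      directions, this shows that all remaining facets share the same \<open>h\<close> and
      \<open>k\<close>.\<close>
    have le: "s' \<le> s" if "\<xi> \<in> N" "\<xi> \<noteq> \<phi>" "bad q \<phi>" "bad p \<psi>" "\<xi> \<noteq> \<psi>" "s \<ge> 1"
      "\<xi> \<bullet> (q - s *\<^sub>R p) = -1" "q - s' *\<^sub>R p \<in> V" for \<xi> q p s s' \<phi> \<psi>
    proof -
      have q: "\<xi> \<bullet> q \<ge> 0" "\<xi> \<bullet> p \<ge> 0" using badD(6) that by blast+
      have e: "\<xi> \<bullet> q - s * (\<xi> \<bullet> p) = -1" using that by (simp add: inner_diff_right)
      then have "\<xi> \<bullet> p \<noteq> 0" using q by auto
      then have p: "\<xi> \<bullet> p > 0" using q by simp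
      have "\<xi> \<bullet> q - s' * (\<xi> \<bullet> p) \<ge> -1" using P_ge[OF V_P[OF that(8)] that(1)] by (simp add: inner_diff_right)
      then have "s' * (\<xi> \<bullet> p) \<le> s * (\<xi> \<bullet> p)" using e by linarith
      then show ?thesis using p by simp
    qed
    have "h' = h"
      using le[OF \<zeta>1(1,3) u m \<zeta>1(2) hk(1,7) hk'(3)] le[OF \<zeta>(1,3) u m \<zeta>(2) hk'(1,5) hk(3)] by simp
    moreover have "k' = k"
      using le[OF \<zeta>1(1,2) m u \<zeta>1(3) hk(2,8) hk'(4)] le[OF \<zeta>(1,2) m u \<zeta>(3) hk'(2,6) hk(4)] by simp
    moreover obtain a where a: "\<zeta> \<bullet> m = real_of_int a"
      using inner_Ints[OF \<zeta>(1) badD(2)[OF m]] by (auto elim: Ints_cases)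
    moreover obtain b where b: "\<zeta> \<bullet> u = real_of_int b"
      using inner_Ints[OF \<zeta>(1) badD(2)[OF u]] by (auto elim: Ints_cases)
    ultimately have "real_of_int b = real_of_int (hi * a - 1)" "real_of_int a = real_of_int (ki * b - 1)"
      using hk'(5,6) hi ki by (simp_all add: inner_diff_right)
    then have "b = hi * a - 1" "a = ki * b - 1" by (simp_all only: of_int_eq_iff)
    moreover have "a \<ge> 0" "b \<ge> 0" using badD(6)[OF m \<zeta>(1,2)] badD(6)[OF u \<zeta>(1,3)] a b by auto
    ultimately show ?thesis using a b by blast
  qed
  obtain a b where ab: "a \<ge> 0" "b \<ge> 0" "b = hi * a - 1" "a = ki * b - 1"
    using coeffs[OF \<zeta>1] by blast
  have muL: "m + u \<in> L" by (rule bad_pair_sum_in_L[OF m u z])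
  \<comment> \<open>Subtracting the vertex \<open>u - h *\<^sub>R m\<close> from
    \<open>m + u\<close> leaves \<open>(h + 1) *\<^sub>R m\<close>; the vertex
    \<open>m - k *\<^sub>R u\<close> likewise gives \<open>(k + 1) *\<^sub>R u\<close>.\<close>
  have hL: "(h + 1) *\<^sub>R m \<in> L"
    using L_diff[OF muL V_L[OF hk(3)]] by (simp add: algebra_simps)
  have kuL: "(k + 1) *\<^sub>R u \<in> L"
    using L_diff[OF muL V_L[OF hk(4)]] by (simp add: algebra_simps)
  have kL: "(k + 1) *\<^sub>R m \<in> L"
    using L_diff[OF L_scaleR[OF muL, of "k + 1"] kuL] hk(6) by (simp add: scaleR_add_right)
  consider "a = 1" | "b = 1" | "hi = 1" "ki = 2" | "hi = 2" "ki = 1"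
    using small_cofactors[OF hki ab] by blast
  then show False
  proof cases
    case 1
    have t: "\<zeta> \<bullet> m = 1" if \<zeta>: "\<zeta> \<in> N" "\<zeta> \<noteq> \<eta>" "\<zeta> \<noteq> \<theta>" for \<zeta>
    proof -
      obtain a' b' :: int where ab': "\<zeta> \<bullet> m = a'" "b' = hi * a' - 1" "a' = ki * b' - 1"
        using coeffs[OF \<zeta>] by blast
      have "a' = 1" by (rule cofactors_one[OF hki(2) ab(3,4) 1]) (fact ab')+
      then show ?thesis using ab'(1) by simp
    qed
    \<comment> \<open>The value at \<open>- m\<close> is 1 on \<eta>, 0 on \<theta> and -1 on every
      remaining normal. So \<open>- m\<close> lies in \<open>P\<close> and on the two facets
      \<zeta>1 and \<zeta>2.\<close>
    have "\<zeta> \<bullet> (- m) \<ge> -1" if "\<zeta> \<in> N" for \<zeta>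
      using t[OF that] z badD(5)[OF m] by (cases "\<zeta> = \<eta>"; cases "\<zeta> = \<theta>") auto
    then have "- m \<in> P" by (simp add: P_eq)
    then have "- m \<in> L"
      using L_ridge[OF \<zeta>1(1) \<zeta>2(1) \<zeta>2(4)[symmetric]] t[OF \<zeta>1] t[OF \<zeta>2(1-3)] badD(2)[OF m]
      by (simp add: lattice_point_uminus)
    then show False using L_uminus badD(3)[OF m] by force
  next
    case 2
    have t: "\<zeta> \<bullet> u = 1" if \<zeta>: "\<zeta> \<in> N" "\<zeta> \<noteq> \<eta>" "\<zeta> \<noteq> \<theta>" for \<zeta>
    proof -
      obtain a' b' :: int where ab': "\<zeta> \<bullet> u = b'" "b' = hi * a' - 1" "a' = ki * b' - 1"
        using coeffs[OF \<zeta>] by blast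
      have "b' = 1" by (rule cofactors_one[OF hki(1) ab(4,3) 2]) (fact ab')+
      then show ?thesis using ab'(1) by simp
    qed
    have "\<zeta> \<bullet> (- u) \<ge> -1" if "\<zeta> \<in> N" for \<zeta>
      using t[OF that] z badD(5)[OF u] by (cases "\<zeta> = \<eta>"; cases "\<zeta> = \<theta>") auto
    then have "- u \<in> P" by (simp add: P_eq)
    then have "- u \<in> L"
      using L_ridge[OF \<zeta>1(1) \<zeta>2(1) \<zeta>2(4)[symmetric]] t[OF \<zeta>1] t[OF \<zeta>2(1-3)] badD(2)[OF u]
      by (simp add: lattice_point_uminus)
    then show False using L_uminus badD(3)[OF u] by force
  next
    case 3
    then show False using L_diff[OF kL hL] hi ki badD(3)[OF m]
      by (simp flip: scaleR_left_diff_distrib)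
  next
    case 4
    then show False using L_diff[OF hL kL] hi ki badD(3)[OF m]
      by (simp flip: scaleR_left_diff_distrib)
  qed
qed

lemma lattice_point_in_L: "y \<in> P \<Longrightarrow> lattice_point y \<Longrightarrow> y \<in> L"
  using exists_bad not_bad by blast

end

section \<open>Duality and extreme points of the dual\<close>

lemma dual_polytope_convex_hull: "u \<in> dual_polytope (convex hull V) \<longleftrightarrow> (\<forall>v\<in>V. u \<bullet> v \<ge> -1)"
proof
  assume "\<forall>v\<in>V. u \<bullet> v \<ge> -1"
  then have "convex hull V \<subseteq> {x. u \<bullet> x \<ge> -1}"
    by (intro hull_minimal) (auto simp: convex_halfspace_ge)
  then show "u \<in> dual_polytope (convex hull V)" by (auto simp: dual_polytope_def)
qed (auto simp: dual_polytope_def hull_inc)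

text \<open>A point outside \<open>P\<close> is strictly separated by some \<open>a\<close> and
  \<open>b\<close>; since 0 is in \<open>P\<close>, \<open>b\<close> is negative, and scaling
  \<open>a\<close> by \<open>1 / (- b)\<close> turns it into an element of the dual that the point
  violates.\<close>

lemma bipolar:
  fixes P :: "(real^'n) set"
  assumes "convex P" "closed P" "0 \<in> P"
  shows "P = {x. \<forall>u\<in>dual_polytope P. u \<bullet> x \<ge> -1}"
proof
  show "{x. \<forall>u\<in>dual_polytope P. u \<bullet> x \<ge> -1} \<subseteq> P"
  proof (rule ccontr)
    assume "\<not> ?thesis"
    then obtain z where z: "z \<notin> P" and zd: "\<And>u. u \<in> dual_polytope P \<Longrightarrow> u \<bullet> z \<ge> -1" by blast
    obtain a b where ab: "a \<bullet> z < b" "\<And>x. x \<in> P \<Longrightarrow> b < a \<bullet> x"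
      using separating_hyperplane_closed_point[OF assms(1,2) z] by blast
    have b: "b < 0" using ab(2)[OF assms(3)] by simp
    define u where "u = (1 / (- b)) *\<^sub>R a"
    have "u \<in> dual_polytope P"
      unfolding dual_polytope_def u_def
    proof (intro CollectI ballI)
      fix x assume "x \<in> P"
      then show "(1 / (- b)) *\<^sub>R a \<bullet> x \<ge> -1" using ab(2)[of x] b by (simp add: field_simps)
    qed
    then have "u \<bullet> z \<ge> -1" by (rule zd)
    then show False using ab(1) b by (simp add: u_def field_simps)
  qed
qed (auto simp: dual_polytope_def)

text \<open>If \<open>d\<close> were nonzero, both \<open>\<zeta> + e *\<^sub>R d\<close> and
  \<open>\<zeta> - e *\<^sub>R d\<close> would lie in the dual for small positive \<open>e\<close>:
  tight constraints do not change and the others have slack. Then \<zeta> would be a midpoint, hence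
  not extreme.\<close>

lemma extreme_point_dual_tight:
  fixes V :: "(real^'n) set"
  assumes V: "finite V" and \<zeta>: "\<zeta> extreme_point_of dual_polytope (convex hull V)"
    and d: "\<And>v. v \<in> V \<Longrightarrow> \<zeta> \<bullet> v = -1 \<Longrightarrow> d \<bullet> v = 0"
  shows "d = 0"
proof (rule ccontr)
  assume d0: "d \<noteq> 0"
  have \<zeta>d: "\<zeta> \<in> dual_polytope (convex hull V)" using \<zeta> by (simp add: extreme_point_of_def)
  \<comment> \<open>Working with the filter \<open>at_right 0\<close> yields one \<open>e\<close>
    for all of the finitely many vertices.\<close>
  have "\<forall>v\<in>V. \<forall>\<^sub>F e in at_right 0. e * \<bar>d \<bullet> v\<bar> \<le> \<zeta> \<bullet> v + 1"
  proof
    fix v assume v: "v \<in> V"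
    show "\<forall>\<^sub>F e in at_right 0. e * \<bar>d \<bullet> v\<bar> \<le> \<zeta> \<bullet> v + 1"
    proof (cases "\<zeta> \<bullet> v = -1")
      case True
      then show ?thesis using d[OF v] by simp
    next
      case False
      then have pos: "0 < \<zeta> \<bullet> v + 1" using \<zeta>d v by (force simp: dual_polytope_convex_hull)
      have "((\<lambda>e. e * \<bar>d \<bullet> v\<bar>) \<longlongrightarrow> 0 * \<bar>d \<bullet> v\<bar>) (at_right 0)"
        by (intro tendsto_intros)
      then have "\<forall>\<^sub>F e in at_right 0. e * \<bar>d \<bullet> v\<bar> < \<zeta> \<bullet> v + 1"
        by (rule order_tendstoD) (use pos in simp)
      then show ?thesis by eventually_elim simp
    qed
  qed
  then have "\<forall>\<^sub>F e in at_right 0. \<forall>v\<in>V. e * \<bar>d \<bullet> v\<bar> \<le> \<zeta> \<bullet> v + 1"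
    using V by (simp add: eventually_ball_finite_distrib)
  moreover have "\<forall>\<^sub>F e in at_right (0::real). e > 0" by (rule eventually_at_right_less)
  ultimately have "\<forall>\<^sub>F e in at_right 0. e > 0 \<and> (\<forall>v\<in>V. e * \<bar>d \<bullet> v\<bar> \<le> \<zeta> \<bullet> v + 1)"
    by eventually_elim simp
  then obtain e where e: "e > 0" "\<And>v. v \<in> V \<Longrightarrow> e * \<bar>d \<bullet> v\<bar> \<le> \<zeta> \<bullet> v + 1"
    using eventually_happens'[OF trivial_limit_at_right_real] by blast
  have "(\<zeta> + s *\<^sub>R d) \<in> dual_polytope (convex hull V)" if s: "\<bar>s\<bar> = e" for s
    unfolding dual_polytope_convex_hull
  proof
    fix v assume "v \<in> V"
    moreover have "\<bar>s * (d \<bullet> v)\<bar> = e * \<bar>d \<bullet> v\<bar>" using s by (simp add: abs_mult)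
    ultimately have "\<bar>s * (d \<bullet> v)\<bar> \<le> \<zeta> \<bullet> v + 1" using e(2) by simp
    then show "(\<zeta> + s *\<^sub>R d) \<bullet> v \<ge> -1" by (simp add: inner_add_left)
  qed
  from this[of e] this[of "- e"] have "\<zeta> + e *\<^sub>R d \<in> dual_polytope (convex hull V)"
    "\<zeta> - e *\<^sub>R d \<in> dual_polytope (convex hull V)" using e by auto
  moreover have "\<zeta> \<in> open_segment (\<zeta> - e *\<^sub>R d) (\<zeta> + e *\<^sub>R d)"
  proof -
    have "\<zeta> = midpoint (\<zeta> - e *\<^sub>R d) (\<zeta> + e *\<^sub>R d)"
      by (simp add: midpoint_def flip: scaleR_2)
    moreover have "\<zeta> - e *\<^sub>R d \<noteq> \<zeta> + e *\<^sub>R d"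
    proof
      assume "\<zeta> - e *\<^sub>R d = \<zeta> + e *\<^sub>R d"
      then have "(2 * e) *\<^sub>R d = 0" by (simp add: algebra_simps flip: scaleR_add_left)
      then show False using d0 e by simp
    qed
    ultimately show ?thesis by (metis midpoint_in_open_segment)
  qed
  ultimately show False using \<zeta> by (auto simp: extreme_point_of_def)
qed

section \<open>Faces of codimension two\<close>

text \<open>\<open>skeleton\<close> collects faces of exactly the given dimension, so a smaller face
  has to be enlarged: it lies in a facet \<open>F\<close> of \<open>P\<close>, and then in a facet
  \<open>G\<close> of \<open>F\<close>.\<close>

lemma small_face_subset_skeleton:
  fixes P :: "(real^'n) set"
  assumes P: "polyhedron P" "aff_dim P = int CARD('n)"
    and T: "T face_of P" "T \<noteq> {}" "aff_dim T \<le> int CARD('n) - 2"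
  shows "T \<subseteq> skeleton (int CARD('n) - 2) P"
proof -
  have "T \<noteq> P" using T P by auto
  then obtain F where F: "F facet_of P" "T \<subseteq> F"
    using face_of_polyhedron_subset_facet[OF P(1) T(1,2)] by blast
  have Fd: "F face_of P" "aff_dim F = int CARD('n) - 1" using F P by (auto simp: facet_of_def)
  have Fp: "polyhedron F" using face_of_polyhedron_polyhedron P Fd by blast
  have TF: "T face_of F" using face_of_subset[OF T(1) F(2) face_of_imp_subset[OF Fd(1)]] .
  have "T \<noteq> F" using T Fd by auto
  then obtain G where G: "G facet_of F" "T \<subseteq> G"
    using face_of_polyhedron_subset_facet[OF Fp TF T(2)] by blast
  have "G face_of P" "aff_dim G = int CARD('n) - 2"
    using G Fd face_of_trans by (auto simp: facet_of_def)
  then show ?thesis using G by (auto simp: skeleton_def)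
qed

text \<open>Two hyperplanes with the same right-hand side -1 coincide only if their normals agree,
  so a nonempty intersection drops the dimension by two.\<close>

lemma aff_dim_two_hyperplanes:
  fixes \<eta> \<theta> :: "real^'n"
  assumes "\<eta> \<noteq> \<theta>"
  shows "aff_dim ({x. \<eta> \<bullet> x = -1} \<inter> {x. \<theta> \<bullet> x = -1}) \<le> int CARD('n) - 2"
proof (cases "{x. \<eta> \<bullet> x = -1} \<inter> {x. \<theta> \<bullet> x = -1} = {}")
  case True
  then show ?thesis using zero_less_card_finite[where 'a='n] by simp
next
  case False
  then have \<eta>: "\<eta> \<noteq> 0" by auto
  have "\<not> {x. \<eta> \<bullet> x = -1} \<subseteq> {x. \<theta> \<bullet> x = -1}"
  proof
    assume sub: "{x. \<eta> \<bullet> x = -1} \<subseteq> {x. \<theta> \<bullet> x = -1}"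
    \<comment> \<open>This is the point of the first hyperplane nearest to the origin. It gives
      \<open>\<theta> \<bullet> \<eta> = \<eta> \<bullet> \<eta>\<close>, so moving along
      \<open>\<theta> - \<eta>\<close> stays in that hyperplane, and \<theta> must be constant along
      this direction too.\<close>
    define p where "p = (- 1 / (\<eta> \<bullet> \<eta>)) *\<^sub>R \<eta>"
    have p: "\<eta> \<bullet> p = -1" using \<eta> by (simp add: p_def)
    then have "\<theta> \<bullet> p = -1" using sub by auto
    then have e: "\<theta> \<bullet> \<eta> = \<eta> \<bullet> \<eta>" using \<eta> by (simp add: p_def field_simps)
    have "\<eta> \<bullet> (p + (\<theta> - \<eta>)) = -1"
      using p e by (simp add: inner_add_right inner_diff_right inner_commute)
    then have "\<theta> \<bullet> (p + (\<theta> - \<eta>)) = -1" using sub by blast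
    then have "\<theta> \<bullet> (\<theta> - \<eta>) = 0" using \<open>\<theta> \<bullet> p = -1\<close> by (simp add: inner_add_right)
    then have "(\<theta> - \<eta>) \<bullet> (\<theta> - \<eta>) = 0"
      using e by (simp add: inner_diff_right inner_diff_left inner_commute)
    then show False using assms by simp
  qed
  then show ?thesis
    using False \<eta> by (simp add: aff_dim_affine_Int_hyperplane affine_hyperplane)
qed

section \<open>The polytope and the vertices of its dual as an instance of the setting\<close>

theorem theorem1:
  fixes P :: "(real^'n) set"
  assumes "CARD('n) \<ge> 3"
    and "reflexive_polytope P"
  shows "Lambda (int CARD('n) - 2) P = Lambda (int CARD('n) - 1) P"
proof -
  define N where "N = {\<eta>. \<eta> extreme_point_of dual_polytope P}"
  define V where "V = {v. v extreme_point_of P}"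
  define L where "L = Lambda (int CARD('n) - 2) P"
  have poly: "polytope P" "polytope (dual_polytope P)" and dimP: "aff_dim P = int CARD('n)"
    and int0: "0 \<in> interior P"
    and Vl: "\<And>v. v \<in> V \<Longrightarrow> lattice_point v" and Nl: "\<And>\<eta>. \<eta> \<in> N \<Longrightarrow> lattice_point \<eta>"
    using assms(2) by (auto simp: reflexive_polytope_def lattice_polytope_def N_def V_def)
  have hull: "P = convex hull V" "dual_polytope P = convex hull N"
    unfolding V_def N_def
    by (intro Krein_Milman_Minkowski poly polytope_imp_compact polytope_imp_convex)+
  have finV: "finite V" unfolding V_def by (rule finite_polyhedron_extreme_points)
      (use poly polytope_imp_polyhedron in blast)
  \<comment> \<open>The polytope is cut out by its whole dual and hence, by linearity on the hull,
    already by the vertices \<open>N\<close> of the dual.\<close>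
  have "P = {x. \<forall>u\<in>dual_polytope P. u \<bullet> x \<ge> -1}"
    using int0 interior_subset poly
    by (intro bipolar polytope_imp_convex compact_imp_closed polytope_imp_compact) auto
  also have "\<dots> = {x. \<forall>\<eta>\<in>N. \<eta> \<bullet> x \<ge> -1}"
    using dual_polytope_convex_hull[of _ N] unfolding hull(2)
    by (auto simp: dual_polytope_def inner_commute)
  finally have P_eq: "P = {x. \<forall>\<eta>\<in>N. \<eta> \<bullet> x \<ge> -1}" .
  have small: "y \<in> L" if "T face_of P" "y \<in> T" "aff_dim T \<le> int CARD('n) - 2" "lattice_point y" for y T
  proof -
    have "T \<noteq> {}" using that(2) by blast
    then have "T \<subseteq> skeleton (int CARD('n) - 2) P"
      by (intro small_face_subset_skeleton polytope_imp_polyhedron poly dimP that)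
    then have "y \<in> {x \<in> skeleton (int CARD('n) - 2) P. lattice_point x}" using that by blast
    then show ?thesis
      unfolding L_def Lambda_def by (rule subsetD[OF lattice_generated_superset])
  qed
  interpret reflexive_setting P N V L
  proof
    show "CARD('n) \<ge> 3" by fact
    show "P = {x. \<forall>\<eta>\<in>N. \<eta> \<bullet> x \<ge> -1}" by fact
    show "P = convex hull V" by fact
    show "bounded P" using poly by (simp add: polytope_imp_bounded)
    show "0 \<in> interior P" by fact
  next
    fix \<eta> d assume "\<eta> \<in> N" "\<And>v. v \<in> V \<Longrightarrow> \<eta> \<bullet> v = -1 \<Longrightarrow> d \<bullet> v = 0"
    then show "d = 0" using extreme_point_dual_tight[OF finV, of \<eta> d] hull(1) by (simp add: N_def)
  next
    fix v assume v: "v \<in> V"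
    then have "{v} face_of P" by (simp add: V_def face_of_singleton)
    then show "v \<in> L" using small[of "{v}" v] Vl[OF v] assms(1) by simp
    show "v \<noteq> 0" using v int0 extreme_point_not_in_interior by (auto simp: V_def)
  next
    fix \<eta> \<theta> y
    assume N: "\<eta> \<in> N" "\<theta> \<in> N" "\<eta> \<noteq> \<theta>" and y: "y \<in> P" "lattice_point y" "\<eta> \<bullet> y = -1" "\<theta> \<bullet> y = -1"
    let ?T = "(P \<inter> {x. \<eta> \<bullet> x = -1}) \<inter> (P \<inter> {x. \<theta> \<bullet> x = -1})"
    have face: "(P \<inter> {x. \<zeta> \<bullet> x = -1}) face_of P" if "\<zeta> \<in> N" for \<zeta>
      by (rule face_of_Int_supporting_hyperplane_ge)
        (use that P_eq poly polytope_imp_convex in auto)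
    have "aff_dim ?T \<le> aff_dim ({x. \<eta> \<bullet> x = -1} \<inter> {x. \<theta> \<bullet> x = -1})"
      by (rule aff_dim_subset) auto
    also have "\<dots> \<le> int CARD('n) - 2" by (rule aff_dim_two_hyperplanes[OF N(3)])
    finally show "y \<in> L"
      using small[of ?T y] face_of_Int face[OF N(1)] face[OF N(2)] y by blast
  next
    show "0 \<in> L" unfolding L_def Lambda_def lattice_generated_def
      by (intro CollectI exI[of _ "{}"]) auto
  qed (auto simp: Vl Nl L_def Lambda_def lattice_generated_add lattice_generated_scaleR)
  show ?thesis
  proof
    have "skeleton (int CARD('n) - 2) P \<subseteq> skeleton (int CARD('n) - 1) P"
    proof
      fix x assume "x \<in> skeleton (int CARD('n) - 2) P"
      then obtain T where T: "T face_of P" "aff_dim T = int CARD('n) - 2" "x \<in> T"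
        by (auto simp: skeleton_def)
      have "T \<noteq> P" using T dimP by auto
      then obtain F where "F facet_of P" "T \<subseteq> F"
        using face_of_polyhedron_subset_facet[OF polytope_imp_polyhedron[OF poly(1)] T(1)] T(3) by blast
      then show "x \<in> skeleton (int CARD('n) - 1) P"
        using T dimP by (auto simp: skeleton_def facet_of_def)
    qed
    then show "Lambda (int CARD('n) - 2) P \<subseteq> Lambda (int CARD('n) - 1) P"
      unfolding Lambda_def
      by (intro lattice_generated_least order_trans[OF _ lattice_generated_superset]) blast
    \<comment> \<open>This is the substantial inclusion: with bad points excluded, every lattice
      point of \<open>P\<close> lies in \<open>L\<close>, in particular those on facets.\<close>
    have "{x \<in> skeleton (int CARD('n) - 1) P. lattice_point x} \<subseteq> L"
      using lattice_point_in_L by (auto simp: skeleton_def dest: face_of_imp_subset)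
    then show "Lambda (int CARD('n) - 1) P \<subseteq> Lambda (int CARD('n) - 2) P"
      unfolding L_def Lambda_def by (rule lattice_generated_least)
  qed
qed

end
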